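(* Let $V$ be a barrelled locally convex space, $\Omega\subseteq V$ an open convex set and $f : \Omega\to\mathbb{R}$ a lower semicontinuous convex function. Then $f$ is continuous.
   Context: A barrel in a locally convex space is a closed absolutely convex absorbing subset; $V$ is barrelled if every barrel is a neighborhood of $0$. *)

theory Defs
  imports "HOL-Analysis.Analysis"
begin

text \<open>
  The scalar type has the sort \<open>{real_normed_field, euclidean_space}\<close>: a finite-dimensional real
  normed field is (isometrically isomorphic to) the reals or the complex numbers, so this treats
  real and complex locally convex spaces at once. The class \<open>real_vector\<close> on the vectors provides
  the underlying real structure used by \<^const>\<open>convex\<close> and \<^const>\<open>convex_on\<close>;
  \<open>scale_of_real\<close> says that it is the restriction of the scalar action. For real spaces take
  \<open>scale = scaleR\<close>. No Hausdorff assumption is made.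
\<close>

locale locally_convex_space = vector_space scale
  for scale :: "'k::{real_normed_field,euclidean_space} \<Rightarrow>
                'v::{real_vector,topological_ab_group_add} \<Rightarrow> 'v" +
  assumes scale_of_real: "scale (of_real r) x = r *\<^sub>R x"
    and continuous_scale: "continuous_on UNIV (\<lambda>(k, x). scale k x)"
    and locally_convex: "open (U :: 'v set) \<Longrightarrow> 0 \<in> U \<Longrightarrow> \<exists>C. convex C \<and> 0 \<in> interior C \<and> C \<subseteq> U"
begin

definition absolutely_convex :: "'v set \<Rightarrow> bool" where
  "absolutely_convex A \<longleftrightarrow>
    (\<forall>x\<in>A. \<forall>y\<in>A. \<forall>a b. norm a + norm b \<le> 1 \<longrightarrow> scale a x + scale b y \<in> A)"

definition absorbing :: "'v set \<Rightarrow> bool" where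
  "absorbing A \<longleftrightarrow> (\<forall>x. \<exists>r>0. \<forall>k. norm k \<le> r \<longrightarrow> scale k x \<in> A)"

definition barrel :: "'v set \<Rightarrow> bool" where
  "barrel B \<longleftrightarrow> closed B \<and> absolutely_convex B \<and> absorbing B"

end

locale barrelled_space = locally_convex_space scale
  for scale :: "'k::{real_normed_field,euclidean_space} \<Rightarrow>
                'v::{real_vector,topological_ab_group_add} \<Rightarrow> 'v" +
  assumes barrel_nhd: "barrel B \<Longrightarrow> 0 \<in> interior B"

definition lower_semicontinuous_on ::
  "'a::topological_space set \<Rightarrow> ('a \<Rightarrow> real) \<Rightarrow> bool" where
  "lower_semicontinuous_on S f \<longleftrightarrow>
    (\<forall>x\<in>S. \<forall>c. c < f x \<longrightarrow> (\<forall>\<^sub>F y in at x within S. c < f y))"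

end

theory Submission
  imports Defs
begin

text \<open>
  Lower semicontinuity is one half of continuity, so it remains to find, for \<open>x \<in> \<Omega>\<close> and
  \<open>c > f x\<close>, a neighbourhood of \<open>x\<close> on which \<open>f \<le> c\<close>. Let \<open>D\<close> be the translated sublevel set
  \<open>{v. x + v \<in> \<Omega> \<and> f (x + v) \<le> c}\<close> and let \<open>B\<close> be the closure of its balanced core. Along each
  scalar line, \<open>f\<close> is a convex function on an open subset of a finite-dimensional space and hence
  continuous; so \<open>D\<close> contains small multiples of every vector, and \<open>B\<close> is a barrel.
  Lower semicontinuity makes \<open>D\<close> relatively closed in \<open>\<Omega> - x\<close>, so that \<open>B \<inter> (\<Omega> - x) \<subseteq> D\<close>.
  Thus no closed neighbourhood inside \<open>\<Omega>\<close> is needed.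
\<close>

lemma convex_on_sublevel_convex:
  assumes "convex_on S f"
  shows "convex {x \<in> S. f x \<le> (c::real)}"
  unfolding convex_def
proof (intro ballI allI impI)
  fix x y and u v :: real
  assume x: "x \<in> {x \<in> S. f x \<le> c}" and y: "y \<in> {x \<in> S. f x \<le> c}"
    and uv: "0 \<le> u" "0 \<le> v" "u + v = 1"
  have "u *\<^sub>R x + v *\<^sub>R y \<in> S"
    using convexD[OF convex_on_imp_convex[OF assms]] x y uv by blast
  moreover have "f (u *\<^sub>R x + v *\<^sub>R y) \<le> u * f x + v * f y"
    using assms x y uv unfolding convex_on_def by blast
  moreover have "u * f x + v * f y \<le> c"
    using convex_bound_le[of "f x" c "f y" u v] x y uv by simp
  ultimately show "u *\<^sub>R x + v *\<^sub>R y \<in> {x \<in> S. f x \<le> c}" by simp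
qed

context locally_convex_space
begin

lemma continuous_on_scale [continuous_intros]:
  assumes "continuous_on S g" "continuous_on S h"
  shows "continuous_on S (\<lambda>x. scale (g x) (h x))"
  using continuous_on_compose2[OF continuous_scale continuous_on_Pair[OF assms]] by simp

lemma scale_scaleR: "scale (r *\<^sub>R k) x = r *\<^sub>R scale k x"
  by (metis scaleR_conv_of_real scale_of_real scale_scale)

text \<open>For fixed \<open>a\<close> and \<open>b\<close> the combination depends continuously on
  the pair, and \<open>closure (A \<times> A)\<close> is
  \<open>closure A \<times> closure A\<close>.\<close>

lemma absolutely_convex_closure:
  assumes "absolutely_convex A"
  shows "absolutely_convex (closure A)"
  unfolding absolutely_convex_def
proof (intro ballI allI impI)
  fix x y and a b :: 'k
  assume xy: "x \<in> closure A" "y \<in> closure A" and ab: "norm a + norm b \<le> 1"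
  let ?h = "\<lambda>p. scale a (fst p) + scale b (snd p)"
  have "?h ` closure (A \<times> A) \<subseteq> closure A"
  proof (rule image_closure_subset)
    show "continuous_on (closure (A \<times> A)) ?h"
      by (intro continuous_intros)
    have "?h ` (A \<times> A) \<subseteq> A"
      using assms ab unfolding absolutely_convex_def by fastforce
    then show "?h ` (A \<times> A) \<subseteq> closure A"
      using closure_subset by blast
  qed simp
  then show "scale a x + scale b y \<in> closure A"
    using xy by (force simp: closure_Times)
qed

text \<open>This is the largest balanced subset of \<open>D\<close>. For convex \<open>D\<close> and
  real scalars it is the intersection of \<open>D\<close> with its reflection in 0.\<close>

definition balanced_core :: "'v set \<Rightarrow> 'v set" where
  "balanced_core D = {v. \<forall>k. norm k \<le> 1 \<longrightarrow> scale k v \<in> D}"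

lemma balanced_core_subset: "balanced_core D \<subseteq> D"
proof
  fix v assume "v \<in> balanced_core D"
  then have "scale 1 v \<in> D"
    unfolding balanced_core_def mem_Collect_eq by (rule allE[of _ 1]) simp
  then show "v \<in> D" by simp
qed

text \<open>In polar form each coefficient is a nonnegative real times a scalar of norm at most 1.
  The latter keeps \<open>x\<close> and \<open>y\<close> inside \<open>D\<close>, which leaves a
  real combination with weights of sum at most 1.\<close>

lemma absolutely_convex_balanced_core:
  assumes D: "convex D" "0 \<in> D"
  shows "absolutely_convex (balanced_core D)"
  unfolding absolutely_convex_def
proof (intro ballI allI impI)
  fix x y and a b :: 'k
  assume x: "x \<in> balanced_core D" and y: "y \<in> balanced_core D" and ab: "norm a + norm b \<le> 1"
  have "scale k (scale a x + scale b y) \<in> D" if k: "norm k \<le> 1" for k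
  proof -
    have polar: "scale j z = norm j *\<^sub>R scale (sgn j) z" for j :: 'k and z
      unfolding scale_scaleR[symmetric] by (cases "j = 0") (simp_all add: sgn_div_norm)
    have in_D: "scale (sgn j) x \<in> D" "scale (sgn j) y \<in> D" for j :: 'k
      using x y by (auto simp: balanced_core_def norm_sgn)
    have "norm (k * a) + norm (k * b) = norm k * (norm a + norm b)"
      by (simp add: norm_mult distrib_left)
    also have "\<dots> \<le> 1"
      using k ab by (simp add: mult_le_one)
    finally have le1: "norm (k * a) + norm (k * b) \<le> 1" .
    have *: "p *\<^sub>R u + q *\<^sub>R v \<in> D"
      if "u \<in> D" "v \<in> D" "0 \<le> p" "0 \<le> q" "p + q \<le> 1" for p q u v
    proof (cases "p + q = 0")
      case True
      then show ?thesis using that D(2) by (simp add: add_nonneg_eq_0_iff)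
    next
      case False
      then have pq: "p + q > 0" using that by simp
      let ?w = "(p / (p + q)) *\<^sub>R u + (q / (p + q)) *\<^sub>R v"
      have "?w \<in> D"
        using D(1) that pq by (intro mem_convex_alt) auto
      \<comment> \<open>The missing weight \<open>1 - (p + q)\<close> is put on the point 0 of
        \<open>D\<close>.\<close>
      then have "(p + q) *\<^sub>R ?w + (1 - (p + q)) *\<^sub>R 0 \<in> D"
        using D(2) that(5) pq by - (rule convexD[OF D(1)], simp_all)
      then show ?thesis using False by (simp add: scaleR_right_distrib)
    qed
    have "norm (k * a) *\<^sub>R scale (sgn (k * a)) x + norm (k * b) *\<^sub>R scale (sgn (k * b)) y \<in> D"
      using le1 in_D by (intro *) auto
    moreover have "scale k (scale a x + scale b y) = scale (k * a) x + scale (k * b) y"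
      by (simp add: scale_right_distrib)
    ultimately show ?thesis using polar by metis
  qed
  then show "scale a x + scale b y \<in> balanced_core D"
    by (simp add: balanced_core_def)
qed

text \<open>The radius found for \<open>D\<close> also serves its core: a further factor of norm at
  most 1 does not increase the norm of \<open>k\<close>.\<close>

lemma absorbing_balanced_core:
  assumes "absorbing D"
  shows "absorbing (balanced_core D)"
  unfolding absorbing_def
proof
  fix x
  obtain r where r: "r > 0" "\<And>k. norm k \<le> r \<Longrightarrow> scale k x \<in> D"
    using assms unfolding absorbing_def by blast
  have "scale k x \<in> balanced_core D" if "norm k \<le> r" for k
    using that r unfolding balanced_core_def
    by (auto simp: norm_mult intro!: r(2) order_trans[OF mult_left_le_one_le])
  then show "\<exists>r>0. \<forall>k. norm k \<le> r \<longrightarrow> scale k x \<in> balanced_core D"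
    using r(1) by blast
qed

lemma absorbing_mono: "absorbing A \<Longrightarrow> A \<subseteq> B \<Longrightarrow> absorbing B"
  unfolding absorbing_def by blast

lemma absorbing_convex_sublevel:
  assumes "open \<Omega>" "convex_on \<Omega> f" "x \<in> \<Omega>" "f x < (c::real)"
  shows "absorbing {v. x + v \<in> \<Omega> \<and> f (x + v) \<le> c}"
  unfolding absorbing_def
proof
  fix y
  define K where "K = (\<lambda>k. x + scale k y) -` \<Omega>"
  have K: "open K"
    unfolding K_def by (intro open_vimage assms continuous_intros)
  \<comment> \<open>Parametrising the line by \<open>k\<close> respects real affine combinations, so
    convexity of \<open>\<Omega>\<close> and of \<open>f\<close> passes to \<open>K\<close> and to
    the pulled-back function.\<close>
  have affine: "x + scale (u *\<^sub>R j + v *\<^sub>R k) y = u *\<^sub>R (x + scale j y) + v *\<^sub>R (x + scale k y)"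
    if "u + v = 1" for u v :: real and j k
  proof -
    have "u *\<^sub>R x + v *\<^sub>R x = x"
      using that by (metis scaleR_left_distrib scaleR_one)
    then show ?thesis
      by (simp add: scale_scaleR algebra_simps)
  qed
  have "convex K"
    using convex_on_imp_convex[OF assms(2)]
    unfolding convex_def K_def by (simp add: affine)
  then have "convex_on K (\<lambda>k. f (x + scale k y))"
    using assms(2) unfolding convex_on_def K_def by (simp add: affine)
  then have "continuous_on K (\<lambda>k. f (x + scale k y))"
    by (rule convex_on_continuous[OF K])
  then have "open (K \<inter> (\<lambda>k. f (x + scale k y)) -` {..<c})"
    using K continuous_on_open_vimage[of K "\<lambda>k. f (x + scale k y)"]
    by (metis Int_commute open_lessThan)
  \<comment> \<open>Strictness of \<open>f x < c\<close> places 0 in an open set, which yields the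
    radius.\<close>
  moreover have "0 \<in> K \<inter> (\<lambda>k. f (x + scale k y)) -` {..<c}"
    using assms by (simp add: K_def)
  ultimately obtain r where "r > 0" "cball 0 r \<subseteq> K \<inter> (\<lambda>k. f (x + scale k y)) -` {..<c}"
    using open_contains_cball by blast
  then show "\<exists>r>0. \<forall>k. norm k \<le> r \<longrightarrow> scale k y \<in> {v. x + v \<in> \<Omega> \<and> f (x + v) \<le> c}"
    by (intro exI[of _ r]) (auto simp: K_def subset_iff dest: less_imp_le)
qed

end

lemma (in barrelled_space) closure_balanced_core_nhd:
  assumes "convex D" "absorbing D"
  shows "0 \<in> interior (closure (balanced_core D))"
proof (rule barrel_nhd)
  have "0 \<in> D"
  proof -
    \<comment> \<open>Absorbing the zero vector means containing it.\<close>
    obtain r where "r > 0" "\<And>k. norm k \<le> r \<Longrightarrow> scale k 0 \<in> D"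
      using assms(2) unfolding absorbing_def by blast
    from this(2)[of 0] this(1) show ?thesis by simp
  qed
  then show "barrel (closure (balanced_core D))"
    unfolding barrel_def
    using absolutely_convex_closure[OF absolutely_convex_balanced_core[OF assms(1)]]
      absorbing_mono[OF absorbing_balanced_core[OF assms(2)] closure_subset]
    by simp
qed

text \<open>If \<open>f x\<close> exceeded \<open>c\<close>, lower semicontinuity would give a
  neighbourhood of \<open>x\<close> that misses the sublevel set.\<close>

lemma lower_semicontinuous_on_closure_sublevel:
  assumes "lower_semicontinuous_on S f" "x \<in> S" "x \<in> closure {y \<in> S. f y \<le> c}"
  shows "f x \<le> c"
proof (rule ccontr)
  assume "\<not> f x \<le> c"
  then have "\<forall>\<^sub>F y in at x within S. c < f y" and "c < f x"
    using assms unfolding lower_semicontinuous_on_def by auto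
  \<comment> \<open>The filter \<open>at x\<close> leaves out \<open>x\<close> itself; that point is
    covered by \<open>c < f x\<close>.\<close>
  then obtain T where T: "open T" "x \<in> T" "\<And>y. y \<in> T \<Longrightarrow> y \<in> S \<Longrightarrow> c < f y"
    unfolding eventually_at_topological by metis
  then have "T \<inter> {y \<in> S. f y \<le> c} \<noteq> {}"
    using assms(3) open_Int_closure_eq_empty by blast
  then show False using T(3) by fastforce
qed

lemma (in barrelled_space) convex_lsc_eventually_le:
  fixes \<Omega> :: "'v set" and f :: "'v \<Rightarrow> real"
  assumes "open \<Omega>" "lower_semicontinuous_on \<Omega> f" "convex_on \<Omega> f" "x \<in> \<Omega>" "f x < c"
  shows "\<forall>\<^sub>F y in at x within \<Omega>. f y \<le> c"
proof -
  define A where "A = {y \<in> \<Omega>. f y \<le> c}"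
  define D where "D = {v. x + v \<in> \<Omega> \<and> f (x + v) \<le> c}"
  have D_A: "D = (+) (- x) ` A"
    unfolding D_def A_def by (force simp: image_iff intro: exI[of _ "x + _"])
  have "convex D"
    unfolding D_A A_def by (intro convex_translation convex_on_sublevel_convex assms)
  then have nhd: "0 \<in> interior (closure (balanced_core D))"
    unfolding D_def by (intro closure_balanced_core_nhd absorbing_convex_sublevel assms)
  define T where "T = (\<lambda>y. y - x) -` interior (closure (balanced_core D))"
  have "open T"
    unfolding T_def by (intro open_vimage continuous_intros) simp
  moreover have "x \<in> T"
    using nhd by (simp add: T_def)
  moreover have "f y \<le> c" if y: "y \<in> T" "y \<in> \<Omega>" for y
  proof (rule lower_semicontinuous_on_closure_sublevel[OF assms(2) y(2)])
    \<comment> \<open>Translation by \<open>x\<close> is continuous, so membership of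
      \<open>y - x\<close> in \<open>closure D\<close> becomes membership of \<open>y\<close> in the
      closure of the sublevel set.\<close>
    have "(+) x ` closure D \<subseteq> closure A"
    proof (rule image_closure_subset)
      show "continuous_on (closure D) ((+) x)"
        by (intro continuous_intros)
      show "(+) x ` D \<subseteq> closure A"
        using closure_subset[of A] unfolding D_A by auto
    qed simp
    moreover have "y - x \<in> closure D"
      using y(1) interior_subset closure_mono[OF balanced_core_subset] unfolding T_def by blast
    ultimately have "x + (y - x) \<in> closure A" by blast
    then show "y \<in> closure {y \<in> \<Omega>. f y \<le> c}" by (simp add: A_def)
  qed
  ultimately show ?thesis
    unfolding eventually_at_topological by blast
qed

theorem theorem4p10:
  fixes scale :: "'k::{real_normed_field,euclidean_space} \<Rightarrow>
                  'v::{real_vector,topological_ab_group_add} \<Rightarrow> 'v"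
    and \<Omega> :: "'v set"
    and f :: "'v \<Rightarrow> real"
  assumes "barrelled_space scale"
    and "open \<Omega>" and "convex \<Omega>"
    and "lower_semicontinuous_on \<Omega> f"
    and "convex_on \<Omega> f"
  shows "continuous_on \<Omega> f"
  unfolding continuous_on_def
proof (intro ballI order_tendstoI)
  fix x a assume "x \<in> \<Omega>" "a < f x"
  then show "\<forall>\<^sub>F y in at x within \<Omega>. a < f y"
    using assms(4) unfolding lower_semicontinuous_on_def by blast
next
  fix x a assume x: "x \<in> \<Omega>" and "f x < a"
  \<comment> \<open>The barrel argument bounds \<open>f\<close> only by a weak inequality, so an
    intermediate level is used.\<close>
  then obtain c where c: "f x < c" "c < a"
    using dense by blast
  have "\<forall>\<^sub>F y in at x within \<Omega>. f y \<le> c"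
    using barrelled_space.convex_lsc_eventually_le[OF assms(1,2,4,5) x c(1)] .
  then show "\<forall>\<^sub>F y in at x within \<Omega>. f y < a"
    by eventually_elim (use c in simp)
qed

end
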